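(* Let $\mathfrak g$ be of type $G_2$ with $c_1=1$, $c_2=3$. Then the highest weight vector $H$ and the lowest weight vector $L$ of $B_0(\lambda)$ are as follows. If $\frac{\lambda_1}{-\lambda_2}>1$: $H=H_{-1}$, $L=L_5$. If $\frac{\lambda_1}{-\lambda_2}=1$: $H=H_{-1}$, $L=L_4$. If $1>\frac{\lambda_1}{-\lambda_2}>\frac23$: $H=H_{-2}$, $L=L_4$. If $\frac{\lambda_1}{-\lambda_2}=\frac23$: $H=H_{-2}$, $L=L_3$. If $\frac23>\frac{\lambda_1}{-\lambda_2}>\frac12$: $H=H_{-3}$, $L=L_3$. If $\frac{\lambda_1}{-\lambda_2}=\frac12$: $H=H_{-3}$, $L=L_2$. If $\frac12>\frac{\lambda_1}{-\lambda_2}>\frac13$: $H=H_{-4}$, $L=L_2$. If $\frac{\lambda_1}{-\lambda_2}=\frac13$: $H=H_{-4}$, $L=L_1$. If $\frac13>\frac{\lambda_1}{-\lambda_2}>0$: $H=H_{-5}$, $L=L_1$.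
   Context: Setting. $\mathfrak g$ has rank 2, $I=\{1,2\}$, with simple roots $\alpha_i$, simple coroots $h_i$ and Cartan matrix $\langle h_1,\alpha_1\rangle=\langle h_2,\alpha_2\rangle=2$, $\langle h_1,\alpha_2\rangle=-c_1$, $\langle h_2,\alpha_1\rangle=-c_2$; here $c_1=1,c_2=3$. Let $\lambda=\lambda_1\Lambda_1+\lambda_2\Lambda_2$ with $\Lambda_i$ the fundamental weights (so $\langle h_i,\lambda\rangle=\lambda_i$), $\lambda_1\in\mathbb Z_{>0}$, $\lambda_2\in\mathbb Z_{<0}$. The crystal $\mathbb Z^\infty_\iota[\lambda]$. Fix $\iota=(\dots,i_2,i_1,t_\lambda,i_{-1},i_{-2},\dots)=(\dots,1,2,1,t_\lambda,2,1,2,\dots)$, i.e. $i_k=1$ for $k>0$ odd, $i_k=2$ for $k>0$ even, $i_{-k}=2$ for $k>0$ odd, $i_{-k}=1$ for $k>0$ even. As a set, $\mathbb Z^\infty_\iota[\lambda]$ consists of the sequences $\vec x=(\dots,x_2,x_1,t_\lambda,x_{-1},x_{-2},\dots)$ with $x_k\in\mathbb Z$ ($k\in\mathbb Z\setminus\{0\}$), all but finitely many zero ($t_\lambda$ is a formal symbol). There is no coordinate $x_0$; sums run over nonzero indices. Put $\sigma_k(\vec x)=x_k+\sum_{j>k}\langle h_{i_k},\alpha_{i_j}\rangle x_j$ for $k\ge1$ and $\sigma_k(\vec x)=-\langle h_{i_k},\lambda\rangle+x_k+\sum_{j>k}\langle h_{i_k},\alpha_{i_j}\rangle x_j$ for $k\le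 -1$. Let $\sigma^{(i)}(\vec x)=\max_{k:\,i_k=i}\sigma_k(\vec x)$ and $M^{(i)}=\{k: i_k=i,\ \sigma_k(\vec x)=\sigma^{(i)}(\vec x)\}$. The crystal operators are: $\tilde e_i\vec x$ is obtained from $\vec x$ by decreasing $x_{\max M^{(i)}}$ by 1 if $\max M^{(i)}$ exists, and $\tilde e_i\vec x=0$ otherwise; $\tilde f_i\vec x$ is obtained from $\vec x$ by increasing $x_{\min M^{(i)}}$ by 1 if $\min M^{(i)}$ exists, and $\tilde f_i\vec x=0$ otherwise. Also $wt(\vec x)=\lambda-\sum_j x_j\alpha_{i_j}$, $\varepsilon_i(\vec x)=\sigma^{(i)}(\vec x)$, $\varphi_i(\vec x)=\langle h_i,wt(\vec x)\rangle+\varepsilon_i(\vec x)$. $B_0(\lambda)$. The crystal $B(U_q(\mathfrak g)a_\lambda)\cong B(\infty)\otimes T_\lambda\otimes B(-\infty)$ of the modified quantum algebra is identified with its image under the unique strict embedding into $\mathbb Z^\infty_\iota[\lambda]$ sending $u_\infty\otimes t_\lambda\otimes u_{-\infty}$ to $(\dots,0,0,t_\lambda,0,0,\dots)$. $B_0(\lambda)$ is its connected component containing $u_\infty\otimes t_\lambda\otimes u_{-\infty}$; equivalently, the connected component of $(\dots,0,0,t_\lambda,0,0,\dots)$ in $\mathbb Z^\infty_\iota[\lambda]$. A highest (resp. lowest) weight vector of a crystal is an element $b$ with $\tilde e_ib=0$ (resp. $\tilde f_ib=0$) for all $i\in I$. The vectors. Let $a_0=a'_0=0$, $a_1=1,a_2=1,a_3=2,a_4=1,a_5=1,a_6=0$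 and $a'_1=1,a'_2=3,a'_3=2,a'_4=3,a'_5=1,a'_6=0$. Put $h_{-2k+1}=a'_{2k-2}\lambda_1+a'_{2k-1}\lambda_2$, $h_{-2k}=a_{2k-1}\lambda_1+a_{2k}\lambda_2$, $l_{2k-1}=a_{2k-1}\lambda_1+a_{2k-2}\lambda_2$, $l_{2k}=a'_{2k}\lambda_1+a'_{2k-1}\lambda_2$ for $k\ge1$ (as far as indices occur), $H_{-j}=(\dots,0,0,t_\lambda,h_{-1},\dots,h_{-j},0,0,\dots)$ and $L_j=(\dots,0,0,l_j,\dots,l_1,t_\lambda,0,0,\dots)$. *)

theory Defs
  imports Complex_Main
begin

datatype idx = One | Two

text \<open>\<open>cartan c1 c2 i j\<close> is the pairing of the simple coroot \<open>h_i\<close> with the simple root \<open>\<alpha>_j\<close>.\<close>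

fun cartan :: "int \<Rightarrow> int \<Rightarrow> idx \<Rightarrow> idx \<Rightarrow> int" where
  "cartan c1 c2 One One = 2"
| "cartan c1 c2 Two Two = 2"
| "cartan c1 c2 One Two = - c1"
| "cartan c1 c2 Two One = - c2"

abbreviation cartan_G2 :: "idx \<Rightarrow> idx \<Rightarrow> int" where
  "cartan_G2 \<equiv> cartan 1 3"

text \<open>An integral weight is given by its coordinates in the basis of fundamental weights,
  so \<open>lam i\<close> is its pairing with \<open>h_i\<close>.\<close>

fun weight :: "int \<Rightarrow> int \<Rightarrow> idx \<Rightarrow> int" where
  "weight l1 l2 One = l1"
| "weight l1 l2 Two = l2"

text \<open>The value \<open>iota 0\<close> is meaningless: position 0 is occupied by the symbol \<open>t_\<lambda>\<close>,
  and every definition below ranges over nonzero positions only.\<close>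

definition iota :: "int \<Rightarrow> idx" where
  "iota k = (if k > 0 then (if odd k then One else Two) else (if odd k then Two else One))"

text \<open>A sequence \<open>(\<dots>, x_2, x_1, t_\<lambda>, x_{-1}, x_{-2}, \<dots>)\<close> is a function on the integers
  whose unused value at 0 is normalised to 0, so that equal sequences are equal functions.\<close>

type_synonym seq = "int \<Rightarrow> int"

definition Zinf :: "seq set" where
  "Zinf = {x. x 0 = 0 \<and> finite {k. x k \<noteq> 0}}"

definition zero_seq :: seq where
  "zero_seq = (\<lambda>_. 0)"

text \<open>Restricting the sum to the support makes it a finite sum.\<close>

definition sigma :: "(idx \<Rightarrow> idx \<Rightarrow> int) \<Rightarrow> (idx \<Rightarrow> int) \<Rightarrow> int \<Rightarrow> seq \<Rightarrow> int" where
  "sigma A lam k x =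
     (if k < 0 then - lam (iota k) else 0) + x k +
     (\<Sum>j | j > k \<and> j \<noteq> 0 \<and> x j \<noteq> 0. A (iota k) (iota j) * x j)"

text \<open>For \<open>x \<in> Zinf\<close> the set of values below is finite, since \<open>sigma A lam k x\<close>
  depends only on \<open>iota k\<close> and the sign of \<open>k\<close> once \<open>\<bar>k\<bar>\<close> is large.\<close>

definition sigma_max :: "(idx \<Rightarrow> idx \<Rightarrow> int) \<Rightarrow> (idx \<Rightarrow> int) \<Rightarrow> idx \<Rightarrow> seq \<Rightarrow> int" where
  "sigma_max A lam i x = Max ((\<lambda>k. sigma A lam k x) ` {k. k \<noteq> 0 \<and> iota k = i})"

definition Mset :: "(idx \<Rightarrow> idx \<Rightarrow> int) \<Rightarrow> (idx \<Rightarrow> int) \<Rightarrow> idx \<Rightarrow> seq \<Rightarrow> int set" where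
  "Mset A lam i x = {k. k \<noteq> 0 \<and> iota k = i \<and> sigma A lam k x = sigma_max A lam i x}"

text \<open>\<open>None\<close> is the extra element 0 of the crystal formalism. \<open>Mset\<close> may be infinite in
  either direction, hence \<open>GREATEST\<close> and \<open>LEAST\<close> rather than \<open>Max\<close> and \<open>Min\<close>.\<close>

definition etilde :: "(idx \<Rightarrow> idx \<Rightarrow> int) \<Rightarrow> (idx \<Rightarrow> int) \<Rightarrow> idx \<Rightarrow> seq \<Rightarrow> seq option" where
  "etilde A lam i x =
     (if \<exists>m\<in>Mset A lam i x. \<forall>k\<in>Mset A lam i x. k \<le> m
      then let m = (GREATEST k. k \<in> Mset A lam i x) in Some (x(m := x m - 1))
      else None)"

definition ftilde :: "(idx \<Rightarrow> idx \<Rightarrow> int) \<Rightarrow> (idx \<Rightarrow> int) \<Rightarrow> idx \<Rightarrow> seq \<Rightarrow> seq option" where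
  "ftilde A lam i x =
     (if \<exists>m\<in>Mset A lam i x. \<forall>k\<in>Mset A lam i x. m \<le> k
      then let m = (LEAST k. k \<in> Mset A lam i x) in Some (x(m := x m + 1))
      else None)"

definition crystal_edge :: "(idx \<Rightarrow> idx \<Rightarrow> int) \<Rightarrow> (idx \<Rightarrow> int) \<Rightarrow> seq \<Rightarrow> seq \<Rightarrow> bool" where
  "crystal_edge A lam x y \<longleftrightarrow>
     x \<in> Zinf \<and> y \<in> Zinf \<and> (\<exists>i. etilde A lam i x = Some y \<or> ftilde A lam i x = Some y)"

text \<open>The component of \<open>u_\<infinity> \<otimes> t_\<lambda> \<otimes> u_{-\<infinity>}\<close>, which the strict embedding of the crystal
  of the modified quantum algebra sends to \<open>zero_seq\<close>. A strict embedding commutes with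
  the crystal operators, so the component can be taken in the ambient crystal.\<close>

definition B0 :: "(idx \<Rightarrow> idx \<Rightarrow> int) \<Rightarrow> (idx \<Rightarrow> int) \<Rightarrow> seq set" where
  "B0 A lam = {x. equivclp (crystal_edge A lam) zero_seq x}"

definition highest_weight_vectors ::
  "(idx \<Rightarrow> idx \<Rightarrow> int) \<Rightarrow> (idx \<Rightarrow> int) \<Rightarrow> seq set \<Rightarrow> seq set" where
  "highest_weight_vectors A lam B = {b \<in> B. \<forall>i. etilde A lam i b = None}"

definition lowest_weight_vectors ::
  "(idx \<Rightarrow> idx \<Rightarrow> int) \<Rightarrow> (idx \<Rightarrow> int) \<Rightarrow> seq set \<Rightarrow> seq set" where
  "lowest_weight_vectors A lam B = {b \<in> B. \<forall>i. ftilde A lam i b = None}"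

text \<open>The type \<open>G_2\<close> coefficient sequences \<open>a_k\<close> and \<open>a'_k\<close>; only indices up to 6 are meaningful.\<close>

definition acoef :: "nat \<Rightarrow> int" where
  "acoef k = [0, 1, 1, 2, 1, 1, 0] ! k"

definition acoef' :: "nat \<Rightarrow> int" where
  "acoef' k = [0, 1, 3, 2, 3, 1, 0] ! k"

text \<open>\<open>hcoord l1 l2 j\<close> and \<open>lcoord l1 l2 j\<close> are \<open>h_{-j}\<close> and \<open>l_j\<close>, for \<open>1 \<le> j \<le> 6\<close>.\<close>

definition hcoord :: "int \<Rightarrow> int \<Rightarrow> nat \<Rightarrow> int" where
  "hcoord l1 l2 j =
     (if odd j then acoef' (j - 1) * l1 + acoef' j * l2
      else acoef (j - 1) * l1 + acoef j * l2)"

definition lcoord :: "int \<Rightarrow> int \<Rightarrow> nat \<Rightarrow> int" where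
  "lcoord l1 l2 j =
     (if odd j then acoef j * l1 + acoef (j - 1) * l2
      else acoef' j * l1 + acoef' (j - 1) * l2)"

definition Hvec :: "int \<Rightarrow> int \<Rightarrow> nat \<Rightarrow> seq" where
  "Hvec l1 l2 j = (\<lambda>k. if - int j \<le> k \<and> k \<le> - 1 then hcoord l1 l2 (nat (- k)) else 0)"

definition Lvec :: "int \<Rightarrow> int \<Rightarrow> nat \<Rightarrow> seq" where
  "Lvec l1 l2 j = (\<lambda>k. if 1 \<le> k \<and> k \<le> int j then lcoord l1 l2 (nat k) else 0)"

end

theory Submission
  imports Defs
begin

text \<open>
  The weight symbol can be moved past an elementary crystal \<open>B_i\<close> at the price of a reflection:
  shifting the entry by \<open>\<langle>h_i, \<lambda>\<rangle>\<close> is an isomorphism \<open>T_\<lambda> \<otimes> B_i \<cong> B_i \<otimes> T_{s_i \<lambda>}\<close>. The symbol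
  can therefore be pushed to the right past the positions \<open>-1, \<dots>, -j\<close>, where it carries the weight \<open>\<mu> = s_{i_{-j}} \<dots> s_{i_{-1}} \<lambda>\<close>; the required shifts are exactly the entries
  \<open>h_{-1}, \<dots>, h_{-j}\<close> of \<open>Hvec\<close> (lemma \<open>sigma_Hvec\<close>). The ratio of the two coordinates of
  \<open>\<lambda>\<close> decides for which \<open>j\<close> the weight \<open>\<mu>\<close> is dominant.

  For dominant \<open>\<mu>\<close> the component is the polyhedral realization of the crystal \<open>B(\<mu>)\<close> by
  Nakashima and Zelevinsky: nothing ever happens to the right of the moved symbol,
  and the six entries next to it on the left range over the integer points of an
  explicit polytope. This polytope is invariant under both operators
  (\<open>polytope_e_step\<close>, \<open>polytope_f_step\<close>); only the origin of the shifted coordinates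
  is killed by both raising operators (\<open>polytope_highest\<close>), and only one other point by
  both lowering operators (\<open>polytope_lowest\<close>). Back in the original coordinates these
  are \<open>H_{-j}\<close> and \<open>L_{6-j}\<close>. The zero sequence lies in the shifted polytope
  (\<open>zero_in_realization\<close>), so its whole component does.

  Existence comes from boundedness: each raising operator lowers the sum of the
  entries, so a walk upwards from the zero sequence must end, and it can end only at the
  single candidate (\<open>unique_extremal_vectors\<close>). At a boundary ratio two consecutive
  values of \<open>j\<close> give a dominant \<open>\<mu>\<close>, which is then singular; for the smaller one the last
  entry of \<open>L_{6-j}\<close> vanishes, so that \<open>L_{6-j} = L_{5-j}\<close>.
\<close>

section \<open>Crystal operators in terms of the values of sigma\<close>

lemma Zinf_upd: "x \<in> Zinf \<Longrightarrow> k \<noteq> 0 \<Longrightarrow> x(k := v) \<in> Zinf"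
  unfolding Zinf_def
  by (simp, rule finite_subset[of _ "insert k {j. x j \<noteq> 0}"]) auto

lemma sigma_finite_support:
  assumes "finite F" "0 \<notin> F" "\<And>j. j \<notin> F \<Longrightarrow> x j = 0"
  shows "sigma A lam k x = (if k < 0 then - lam (iota k) else 0) + x k +
    (\<Sum>j\<in>F. if k < j then A (iota k) (iota j) * x j else 0)"
proof -
  have "(\<Sum>j | j > k \<and> j \<noteq> 0 \<and> x j \<noteq> 0. A (iota k) (iota j) * x j)
      = (\<Sum>j | j > k \<and> j \<noteq> 0 \<and> x j \<noteq> 0. if k < j then A (iota k) (iota j) * x j else 0)"
    by (intro sum.cong) auto
  also have "\<dots> = (\<Sum>j\<in>F. if k < j then A (iota k) (iota j) * x j else 0)"
    using assms by (intro sum.mono_neutral_left) auto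
  finally show ?thesis by (simp add: sigma_def)
qed

lemma sigma_diff:
  assumes "finite F" "0 \<notin> F" "\<And>j. j \<notin> F \<Longrightarrow> x j = 0" "\<And>j. j \<notin> F \<Longrightarrow> y j = 0"
  shows "sigma A lam k x = sigma A lam k y + (x k - y k) +
    (\<Sum>j\<in>F. if k < j then A (iota k) (iota j) * (x j - y j) else 0)"
proof -
  have "(\<Sum>j\<in>F. if k < j then A (iota k) (iota j) * (x j - y j) else 0)
     = (\<Sum>j\<in>F. if k < j then A (iota k) (iota j) * x j else 0)
       - (\<Sum>j\<in>F. if k < j then A (iota k) (iota j) * y j else 0)"
    unfolding sum_subtractf[symmetric] by (intro sum.cong) (auto simp: algebra_simps)
  then show ?thesis
    using sigma_finite_support[OF assms(1,2), of x] sigma_finite_support[OF assms(1,2), of y]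
      assms(3,4) by simp
qed

lemma sigma_upd:
  assumes "x \<in> Zinf" "k \<noteq> 0"
  shows "sigma A lam l (x(k := v)) = sigma A lam l x +
    (if l = k then v - x k else if l < k then A (iota l) (iota k) * (v - x k) else 0)"
proof -
  let ?F = "insert k {j. x j \<noteq> 0}"
  have fin: "finite ?F" "0 \<notin> ?F" using assms by (auto simp: Zinf_def)
  have "(\<Sum>j\<in>?F. if l < j then A (iota l) (iota j) * ((x(k := v)) j - x j) else 0)
      = (\<Sum>j\<in>{k}. if l < j then A (iota l) (iota j) * ((x(k := v)) j - x j) else 0)"
    using fin by (intro sum.mono_neutral_right) auto
  moreover have "sigma A lam l (x(k := v)) = sigma A lam l x + ((x(k := v)) l - x l) +
      (\<Sum>j\<in>?F. if l < j then A (iota l) (iota j) * ((x(k := v)) j - x j) else 0)"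
    by (rule sigma_diff[OF fin]) auto
  ultimately show ?thesis by (cases "l = k") simp_all
qed

lemma iota_above: "\<exists>k>N. k \<noteq> 0 \<and> iota k = i"
proof -
  have "\<exists>k>N. k \<noteq> 0 \<and> iota k = One"
    by (rule exI[of _ "2 * \<bar>N\<bar> + 1"], simp add: iota_def) arith
  moreover have "\<exists>k>N. k \<noteq> 0 \<and> iota k = Two"
    by (rule exI[of _ "2 * \<bar>N\<bar> + 2"], simp add: iota_def) arith
  ultimately show ?thesis by (cases i) simp_all
qed

text \<open>Finiteness of the set of values makes the maximum in the definition of \<open>sigma_max\<close>
  attained: a value is determined by the sign of the position, an entry of the
  sequence, and a subset of its finite support.\<close>

lemma finite_sigma_values:
  assumes "x \<in> Zinf"
  shows "finite ((\<lambda>k. sigma A lam k x) ` {k. k \<noteq> 0 \<and> iota k = i})"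
proof -
  let ?s = "{j. x j \<noteq> 0}"
  have fs: "finite ?s" using assms by (simp add: Zinf_def)
  have "finite (insert 0 (x ` ?s))" using fs by simp
  moreover have "range x \<subseteq> insert 0 (x ` ?s)" by auto
  ultimately have fr: "finite (range x)" by (rule finite_subset[rotated])
  let ?g = "\<lambda>(c, v, J). c + v + (\<Sum>j\<in>J. A i (iota j) * x j)"
  have "finite (?g ` ({0, - lam i} \<times> range x \<times> Pow ?s))"
    using fs fr by blast
  moreover have "(\<lambda>k. sigma A lam k x) ` {k. k \<noteq> 0 \<and> iota k = i}
      \<subseteq> ?g ` ({0, - lam i} \<times> range x \<times> Pow ?s)"
  proof (rule image_subsetI)
    fix k :: int assume "k \<in> {k. k \<noteq> 0 \<and> iota k = i}"
    then show "sigma A lam k x \<in> ?g ` ({0, - lam i} \<times> range x \<times> Pow ?s)"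
      by (intro image_eqI[of _ _ "(if k < 0 then - lam (iota k) else 0, x k,
            {j. j > k \<and> j \<noteq> 0 \<and> x j \<noteq> 0})"]) (auto simp: sigma_def)
  qed
  ultimately show ?thesis by (rule finite_subset[rotated])
qed

lemma Mset_iff:
  assumes "x \<in> Zinf"
  shows "k \<in> Mset A lam i x \<longleftrightarrow> k \<noteq> 0 \<and> iota k = i \<and>
    (\<forall>l. l \<noteq> 0 \<longrightarrow> iota l = i \<longrightarrow> sigma A lam l x \<le> sigma A lam k x)"
proof -
  let ?V = "(\<lambda>k. sigma A lam k x) ` {k. k \<noteq> 0 \<and> iota k = i}"
  have "finite ?V" by (rule finite_sigma_values[OF assms])
  moreover have "?V \<noteq> {}" using iota_above[of 0 i] by auto
  ultimately have "v = Max ?V \<longleftrightarrow> v \<in> ?V \<and> (\<forall>w\<in>?V. w \<le> v)" for v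
    by (rule eq_Max_iff)
  from this[of "sigma A lam k x"] show ?thesis
    unfolding Mset_def sigma_max_def by auto
qed

lemma Mset_nonempty:
  assumes "x \<in> Zinf" shows "Mset A lam i x \<noteq> {}"
proof -
  let ?V = "(\<lambda>k. sigma A lam k x) ` {k. k \<noteq> 0 \<and> iota k = i}"
  have "Max ?V \<in> ?V" using finite_sigma_values[OF assms] iota_above[of 0 i]
    by (intro Max_in) auto
  then show ?thesis unfolding Mset_def sigma_max_def by auto
qed

lemma int_greatest_bounded:
  assumes "(a::int) \<in> M" "\<forall>k\<in>M. k \<le> N" shows "\<exists>m\<in>M. \<forall>k\<in>M. k \<le> m"
proof -
  have fin: "finite (M \<inter> {a..N})" by simp
  moreover have ne: "M \<inter> {a..N} \<noteq> {}" using assms by auto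
  ultimately have "Max (M \<inter> {a..N}) \<in> M" using Max_in by blast
  moreover have "k \<le> Max (M \<inter> {a..N})" if "k \<in> M" for k
  proof (cases "a \<le> k")
    case True
    then show ?thesis using that assms(2) fin by (intro Max_ge) auto
  next
    case False
    have "a \<le> Max (M \<inter> {a..N})" using assms fin by (intro Max_ge) auto
    then show ?thesis using False by simp
  qed
  ultimately show ?thesis by blast
qed

lemma int_least_bounded:
  assumes "(a::int) \<in> M" "\<forall>k\<in>M. N \<le> k" shows "\<exists>m\<in>M. \<forall>k\<in>M. m \<le> k"
proof -
  have "\<exists>m\<in>uminus ` M. \<forall>k\<in>uminus ` M. k \<le> m"
    using assms by (intro int_greatest_bounded[of "- a" _ "- N"]) auto
  then show ?thesis by auto
qed

text \<open>The positions at which the operators act, as inequalities between values of sigma: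
  strict on the side from which the extremal maximiser is taken, weak on the other.\<close>

definition e_position where
  "e_position A lam x k \<longleftrightarrow> k \<noteq> 0 \<and>
     (\<forall>l. l \<noteq> 0 \<longrightarrow> iota l = iota k \<longrightarrow> k < l \<longrightarrow> sigma A lam l x < sigma A lam k x) \<and>
     (\<forall>l. l \<noteq> 0 \<longrightarrow> iota l = iota k \<longrightarrow> l < k \<longrightarrow> sigma A lam l x \<le> sigma A lam k x)"

definition f_position where
  "f_position A lam x k \<longleftrightarrow> k \<noteq> 0 \<and>
     (\<forall>l. l \<noteq> 0 \<longrightarrow> iota l = iota k \<longrightarrow> k < l \<longrightarrow> sigma A lam l x \<le> sigma A lam k x) \<and>
     (\<forall>l. l \<noteq> 0 \<longrightarrow> iota l = iota k \<longrightarrow> l < k \<longrightarrow> sigma A lam l x < sigma A lam k x)"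

lemma e_position_iff:
  assumes "x \<in> Zinf"
  shows "e_position A lam x k \<and> iota k = i \<longleftrightarrow>
    k \<in> Mset A lam i x \<and> (\<forall>l\<in>Mset A lam i x. l \<le> k)"
proof
  assume L: "e_position A lam x k \<and> iota k = i"
  then have "sigma A lam l x \<le> sigma A lam k x" if "l \<noteq> 0" "iota l = i" for l
    using that unfolding e_position_def
    by (metis linorder_less_linear order_less_imp_le order_refl)
  then have "k \<in> Mset A lam i x" using L assms by (auto simp: Mset_iff e_position_def)
  moreover have "l \<le> k" if l: "l \<in> Mset A lam i x" for l
  proof (rule ccontr)
    assume "\<not> l \<le> k"
    then have "sigma A lam l x < sigma A lam k x"
      using L l unfolding e_position_def Mset_def by auto
    moreover have "sigma A lam l x = sigma A lam k x"
      using l \<open>k \<in> Mset A lam i x\<close> by (simp add: Mset_def)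
    ultimately show False by simp
  qed
  ultimately show "k \<in> Mset A lam i x \<and> (\<forall>l\<in>Mset A lam i x. l \<le> k)" by blast
next
  assume R: "k \<in> Mset A lam i x \<and> (\<forall>l\<in>Mset A lam i x. l \<le> k)"
  have "sigma A lam l x < sigma A lam k x" if "l \<noteq> 0" "iota l = i" "k < l" for l
  proof -
    have "l \<notin> Mset A lam i x" using R that by auto
    then have "sigma A lam l x \<noteq> sigma A lam k x"
      using that R by (simp add: Mset_def)
    moreover have "sigma A lam l x \<le> sigma A lam k x"
      using R that assms by (auto simp: Mset_iff)
    ultimately show ?thesis by simp
  qed
  then show "e_position A lam x k \<and> iota k = i"
    using R assms unfolding e_position_def by (auto simp: Mset_iff)
qed

lemma f_position_iff:
  assumes "x \<in> Zinf"
  shows "f_position A lam x k \<and> iota k = i \<longleftrightarrow>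
    k \<in> Mset A lam i x \<and> (\<forall>l\<in>Mset A lam i x. k \<le> l)"
proof
  assume L: "f_position A lam x k \<and> iota k = i"
  then have "sigma A lam l x \<le> sigma A lam k x" if "l \<noteq> 0" "iota l = i" for l
    using that unfolding f_position_def
    by (metis linorder_less_linear order_less_imp_le order_refl)
  then have "k \<in> Mset A lam i x" using L assms by (auto simp: Mset_iff f_position_def)
  moreover have "k \<le> l" if l: "l \<in> Mset A lam i x" for l
  proof (rule ccontr)
    assume "\<not> k \<le> l"
    then have "sigma A lam l x < sigma A lam k x"
      using L l unfolding f_position_def Mset_def by auto
    moreover have "sigma A lam l x = sigma A lam k x"
      using l \<open>k \<in> Mset A lam i x\<close> by (simp add: Mset_def)
    ultimately show False by simp
  qed
  ultimately show "k \<in> Mset A lam i x \<and> (\<forall>l\<in>Mset A lam i x. k \<le> l)" by blast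
next
  assume R: "k \<in> Mset A lam i x \<and> (\<forall>l\<in>Mset A lam i x. k \<le> l)"
  have "sigma A lam l x < sigma A lam k x" if "l \<noteq> 0" "iota l = i" "l < k" for l
  proof -
    have "l \<notin> Mset A lam i x" using R that by auto
    then have "sigma A lam l x \<noteq> sigma A lam k x"
      using that R by (simp add: Mset_def)
    moreover have "sigma A lam l x \<le> sigma A lam k x"
      using R that assms by (auto simp: Mset_iff)
    ultimately show ?thesis by simp
  qed
  then show "f_position A lam x k \<and> iota k = i"
    using R assms unfolding f_position_def by (auto simp: Mset_iff)
qed

lemma etilde_eq_Some_iff:
  assumes "x \<in> Zinf"
  shows "etilde A lam i x = Some y \<longleftrightarrow>
    (\<exists>k. e_position A lam x k \<and> iota k = i \<and> y = x(k := x k - 1))"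
proof -
  have "etilde A lam i x = Some (x(m := x m - 1))"
    if "m \<in> Mset A lam i x" "\<forall>l\<in>Mset A lam i x. l \<le> m" for m
  proof -
    have "(GREATEST k. k \<in> Mset A lam i x) = m" using that by (intro Greatest_equality) auto
    then show ?thesis using that unfolding etilde_def by (auto simp: Let_def)
  qed
  note * = this
  show ?thesis
  proof
    assume E: "etilde A lam i x = Some y"
    then obtain m where m: "m \<in> Mset A lam i x" "\<forall>l\<in>Mset A lam i x. l \<le> m"
      unfolding etilde_def by (auto split: if_splits)
    then have "e_position A lam x m \<and> iota m = i"
      by (simp add: e_position_iff[OF assms])
    moreover have "y = x(m := x m - 1)" using *[OF m] E by simp
    ultimately show "\<exists>k. e_position A lam x k \<and> iota k = i \<and> y = x(k := x k - 1)"
      by (intro exI[of _ m] conjI) simp_all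
  next
    assume "\<exists>k. e_position A lam x k \<and> iota k = i \<and> y = x(k := x k - 1)"
    then obtain k where k: "e_position A lam x k \<and> iota k = i" "y = x(k := x k - 1)"
      by (elim exE conjE) (rule that, simp_all)
    then show "etilde A lam i x = Some y"
      using *[of k] unfolding e_position_iff[OF assms] by simp
  qed
qed

lemma ftilde_eq_Some_iff:
  assumes "x \<in> Zinf"
  shows "ftilde A lam i x = Some y \<longleftrightarrow>
    (\<exists>k. f_position A lam x k \<and> iota k = i \<and> y = x(k := x k + 1))"
proof -
  have "ftilde A lam i x = Some (x(m := x m + 1))"
    if "m \<in> Mset A lam i x" "\<forall>l\<in>Mset A lam i x. m \<le> l" for m
  proof -
    have "(LEAST k. k \<in> Mset A lam i x) = m" using that by (intro Least_equality) auto
    then show ?thesis using that unfolding ftilde_def by (auto simp: Let_def)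
  qed
  note * = this
  show ?thesis
  proof
    assume E: "ftilde A lam i x = Some y"
    then obtain m where m: "m \<in> Mset A lam i x" "\<forall>l\<in>Mset A lam i x. m \<le> l"
      unfolding ftilde_def by (auto split: if_splits)
    then have "f_position A lam x m \<and> iota m = i"
      by (simp add: f_position_iff[OF assms])
    moreover have "y = x(m := x m + 1)" using *[OF m] E by simp
    ultimately show "\<exists>k. f_position A lam x k \<and> iota k = i \<and> y = x(k := x k + 1)"
      by (intro exI[of _ m] conjI) simp_all
  next
    assume "\<exists>k. f_position A lam x k \<and> iota k = i \<and> y = x(k := x k + 1)"
    then obtain k where k: "f_position A lam x k \<and> iota k = i" "y = x(k := x k + 1)"
      by (elim exE conjE) (rule that, simp_all)
    then show "ftilde A lam i x = Some y"
      using *[of k] unfolding f_position_iff[OF assms] by simp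
  qed
qed

text \<open>An operator is undefined only if its maximisers run off to infinity, because a
  nonempty bounded set of integers has an extremal element.\<close>

lemma etilde_None_maximisers:
  assumes "x \<in> Zinf" "etilde A lam i x = None"
  shows "\<exists>k>N. iota k = i \<and>
    (\<forall>l. l \<noteq> 0 \<longrightarrow> iota l = i \<longrightarrow> sigma A lam l x \<le> sigma A lam k x)"
proof -
  obtain a where a: "a \<in> Mset A lam i x" using Mset_nonempty[OF assms(1)] by blast
  have "\<not> (\<exists>m\<in>Mset A lam i x. \<forall>k\<in>Mset A lam i x. k \<le> m)"
    using assms(2) unfolding etilde_def Let_def by (rule contrapos_pn) simp
  then have "\<not> (\<forall>k\<in>Mset A lam i x. k \<le> N)" using int_greatest_bounded[OF a] by blast
  then obtain k where "k \<in> Mset A lam i x" "N < k" by (auto simp: not_le)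
  then show ?thesis by (intro exI[of _ k]) (simp add: Mset_iff[OF assms(1)])
qed

lemma ftilde_None_maximisers:
  assumes "x \<in> Zinf" "ftilde A lam i x = None"
  shows "\<exists>k<N. iota k = i \<and>
    (\<forall>l. l \<noteq> 0 \<longrightarrow> iota l = i \<longrightarrow> sigma A lam l x \<le> sigma A lam k x)"
proof -
  obtain a where a: "a \<in> Mset A lam i x" using Mset_nonempty[OF assms(1)] by blast
  have "\<not> (\<exists>m\<in>Mset A lam i x. \<forall>k\<in>Mset A lam i x. m \<le> k)"
    using assms(2) unfolding ftilde_def Let_def by (rule contrapos_pn) simp
  then have "\<not> (\<forall>k\<in>Mset A lam i x. N \<le> k)" using int_least_bounded[OF a] by blast
  then obtain k where "k \<in> Mset A lam i x" "k < N" by (auto simp: not_le)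
  then show ?thesis by (intro exI[of _ k]) (simp add: Mset_iff[OF assms(1)])
qed

section \<open>Extremal vectors of a component\<close>

text \<open>The two operators are mutually inverse: decreasing the entry at the last maximiser
  lowers sigma by 1 there and by 2 at all earlier positions of the same letter,
  so the position becomes the first maximiser.\<close>

lemma ftilde_etilde:
  assumes "\<And>i. A i i = 2" "x \<in> Zinf" "etilde A lam i x = Some y"
  shows "ftilde A lam i y = Some x"
proof -
  obtain k where k: "e_position A lam x k" "iota k = i" "y = x(k := x k - 1)"
    using assms(3) unfolding etilde_eq_Some_iff[OF assms(2)] by (elim exE conjE) (rule that)
  have k0: "k \<noteq> 0" using k by (simp add: e_position_def)
  then have yZ: "y \<in> Zinf" using Zinf_upd assms k by simp
  moreover have "f_position A lam y k"
    using k(1) k0 assms(1) unfolding f_position_def e_position_def k(3)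
    by (auto simp: sigma_upd[OF assms(2) k0])
  moreover have "x = y(k := y k + 1)" using k(3) by simp
  ultimately show ?thesis
    unfolding ftilde_eq_Some_iff[OF yZ] using k(2) by (intro exI[of _ k] conjI)
qed

lemma etilde_ftilde:
  assumes "\<And>i. A i i = 2" "x \<in> Zinf" "ftilde A lam i x = Some y"
  shows "etilde A lam i y = Some x"
proof -
  obtain k where k: "f_position A lam x k" "iota k = i" "y = x(k := x k + 1)"
    using assms(3) unfolding ftilde_eq_Some_iff[OF assms(2)] by (elim exE conjE) (rule that)
  have k0: "k \<noteq> 0" using k by (simp add: f_position_def)
  then have yZ: "y \<in> Zinf" using Zinf_upd assms k by simp
  moreover have "e_position A lam y k"
    using k(1) k0 assms(1) unfolding f_position_def e_position_def k(3)
    by (auto simp: sigma_upd[OF assms(2) k0])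
  moreover have "x = y(k := y k - 1)" using k(3) by simp
  ultimately show ?thesis
    unfolding etilde_eq_Some_iff[OF yZ] using k(2) by (intro exI[of _ k] conjI)
qed

lemma crystal_edge_sym:
  assumes "\<And>i. A i i = 2" "crystal_edge A lam x y" shows "crystal_edge A lam y x"
  using assms ftilde_etilde etilde_ftilde unfolding crystal_edge_def by metis

lemma B0_step: "x \<in> B0 A lam \<Longrightarrow> crystal_edge A lam x y \<Longrightarrow> y \<in> B0 A lam"
  unfolding B0_def by (auto intro: rtranclp.rtrancl_into_rtrancl simp: equivclp_def symclpI)

lemma zero_in_B0: "zero_seq \<in> B0 A lam"
  by (simp add: B0_def)

lemma B0_subset:
  assumes "\<And>i. A i i = 2" "zero_seq \<in> S"
    and step: "\<And>x y. x \<in> S \<Longrightarrow> crystal_edge A lam x y \<Longrightarrow> y \<in> S"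
  shows "B0 A lam \<subseteq> S"
proof
  fix x assume "x \<in> B0 A lam"
  then have "equivclp (crystal_edge A lam) zero_seq x" by (simp add: B0_def)
  then show "x \<in> S"
  proof (induction rule: equivclp_induct)
    case base
    show ?case by (rule assms(2))
  next
    case (step y z)
    then have "crystal_edge A lam y z" using crystal_edge_sym[of A, OF assms(1)] by blast
    then show ?case using step.IH assms(3) by blast
  qed
qed

text \<open>Inside a bounded invariant set the operators lower (or raise) the sum of the
  entries by 1 and so cannot be applied forever. Starting at the origin they
  reach a vector that they kill, and this is the only candidate.\<close>

lemma unique_extremal_vectors:
  assumes A: "\<And>i. A i i = 2" and zero: "zero_seq \<in> S"
    and F: "finite F" "0 \<notin> F"
    and supp: "\<And>x k. x \<in> S \<Longrightarrow> k \<notin> F \<Longrightarrow> x k = 0"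
    and bound: "\<And>x k. x \<in> S \<Longrightarrow> \<bar>x k\<bar> \<le> C"
    and e_pos: "\<And>x k. x \<in> S \<Longrightarrow> e_position A lam x k \<Longrightarrow> k \<in> F \<and> x(k := x k - 1) \<in> S"
    and f_pos: "\<And>x k. x \<in> S \<Longrightarrow> f_position A lam x k \<Longrightarrow> k \<in> F \<and> x(k := x k + 1) \<in> S"
    and high: "\<And>x. x \<in> S \<Longrightarrow> \<forall>i. etilde A lam i x = None \<Longrightarrow> x = h"
    and low: "\<And>x. x \<in> S \<Longrightarrow> \<forall>i. ftilde A lam i x = None \<Longrightarrow> x = l"
  shows "highest_weight_vectors A lam (B0 A lam) = {h}"
    and "lowest_weight_vectors A lam (B0 A lam) = {l}"
proof -
  have Z: "x \<in> Zinf" if "x \<in> S" for x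
    using supp[OF that] F unfolding Zinf_def by (auto intro: finite_subset[OF _ F(1)])
  let ?B = "B0 A lam"
  have sub: "?B \<subseteq> S"
  proof (rule B0_subset[OF A zero])
    fix x y assume "x \<in> S" "crystal_edge A lam x y"
    then show "y \<in> S"
      using e_pos f_pos Z
      by (auto simp: crystal_edge_def etilde_eq_Some_iff ftilde_eq_Some_iff)
  qed
  have sum_upd: "(\<Sum>j\<in>F. (x(k := v)) j) = (\<Sum>j\<in>F. x j) + v - x k" if "k \<in> F" for x :: seq and k v
    using that F by (simp add: sum.remove[of _ k])
  have sum_bound: "\<bar>\<Sum>j\<in>F. x j\<bar> \<le> of_nat (card F) * C" if "x \<in> S" for x
    using order_trans[OF sum_abs sum_bounded_above, of F x C] bound[OF that] by simp
  have "\<exists>y\<in>?B. \<forall>i. etilde A lam i y = None" if "x \<in> ?B" for x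
    using that
  proof (induction "nat (of_nat (card F) * C + (\<Sum>j\<in>F. x j))" arbitrary: x rule: less_induct)
    case less
    show ?case
    proof (cases "\<forall>i. etilde A lam i x = None")
      case False
      then obtain i y where y: "etilde A lam i x = Some y" by auto
      have xS: "x \<in> S" using sub less.prems by blast
      then obtain k where k: "e_position A lam x k" "y = x(k := x k - 1)"
        using y Z etilde_eq_Some_iff by blast
      have yS: "k \<in> F" "y \<in> S" using e_pos[OF xS k(1)] k(2) by auto
      have "y \<in> ?B" using B0_step[OF less.prems] y Z[OF xS] Z[OF yS(2)]
        by (auto simp: crystal_edge_def)
      moreover have "(\<Sum>j\<in>F. y j) = (\<Sum>j\<in>F. x j) - 1"
        unfolding k(2) using yS(1) by (subst sum_upd) auto
      ultimately show ?thesis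
        using less.hyps[of y] sum_bound[OF xS] sum_bound[OF yS(2)] by auto
    qed (use less.prems in blast)
  qed
  then obtain y where y: "y \<in> ?B" "\<forall>i. etilde A lam i y = None" using zero_in_B0 by blast
  then show "highest_weight_vectors A lam ?B = {h}"
    using high sub unfolding highest_weight_vectors_def by auto
  have "\<exists>y\<in>?B. \<forall>i. ftilde A lam i y = None" if "x \<in> ?B" for x
    using that
  proof (induction "nat (of_nat (card F) * C - (\<Sum>j\<in>F. x j))" arbitrary: x rule: less_induct)
    case less
    show ?case
    proof (cases "\<forall>i. ftilde A lam i x = None")
      case False
      then obtain i y where y: "ftilde A lam i x = Some y" by auto
      have xS: "x \<in> S" using sub less.prems by blast
      then obtain k where k: "f_position A lam x k" "y = x(k := x k + 1)"
        using y Z ftilde_eq_Some_iff by blast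
      have yS: "k \<in> F" "y \<in> S" using f_pos[OF xS k(1)] k(2) by auto
      have "y \<in> ?B" using B0_step[OF less.prems] y Z[OF xS] Z[OF yS(2)]
        by (auto simp: crystal_edge_def)
      moreover have "(\<Sum>j\<in>F. y j) = (\<Sum>j\<in>F. x j) + 1"
        unfolding k(2) using yS(1) by (subst sum_upd) auto
      ultimately show ?thesis
        using less.hyps[of y] sum_bound[OF xS] sum_bound[OF yS(2)] by auto
    qed (use less.prems in blast)
  qed
  then obtain z where z: "z \<in> ?B" "\<forall>i. ftilde A lam i z = None" using zero_in_B0 by blast
  then show "lowest_weight_vectors A lam ?B = {l}"
    using low sub unfolding lowest_weight_vectors_def by auto
qed

section \<open>The polytope of a dominant weight\<close>

fun other :: "idx \<Rightarrow> idx" where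
  "other One = Two" | "other Two = One"

text \<open>The model for a weight symbol \<open>t_\<mu>\<close> standing between the positions 0 and 1 of an
  alternating word on all integers, with letter \<open>a\<close> at the odd positions. Here \<open>p\<close> and \<open>q\<close> are
  the pairings of \<open>\<mu>\<close> with the coroots of \<open>a\<close> and of the other letter, and \<open>dsigma\<close> is sigma for
  sequences supported on \<open>{1..6}\<close>.\<close>

definition letter :: "idx \<Rightarrow> int \<Rightarrow> idx" where
  "letter a n = (if odd n then a else other a)"

definition dsigma :: "idx \<Rightarrow> int \<Rightarrow> int \<Rightarrow> (int \<Rightarrow> int) \<Rightarrow> int \<Rightarrow> int" where
  "dsigma a p q z n = (if 0 < n then 0 else if odd n then - p else - q) + z n +
     (\<Sum>m\<in>{1..6}. if n < m then cartan_G2 (letter a n) (letter a m) * z m else 0)"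

text \<open>The inequalities arise by the method of Nakashima and Zelevinsky. Write \<open>\<sigma>_n\<close>
  for \<open>dsigma\<close> at \<open>n\<close>, and let \<open>\<phi>\<close> be an affine form with coefficient \<open>c\<close> at \<open>z n\<close>. If \<open>c > 0\<close> and a raising operator acts at \<open>n\<close>, then
  \<open>\<sigma>_n - \<sigma>_{n+2} \<ge> 1\<close>, so \<open>\<phi>\<close> stays nonnegative as soon as
  \<open>\<phi> - c (\<sigma>_n - \<sigma>_{n+2})\<close> is nonnegative; if \<open>c < 0\<close>, a lowering operator and \<open>n - 2\<close> take
  their place. Closing up \<open>z n \<ge> 0\<close>, \<open>\<sigma>_5, \<sigma>_6 \<ge> 0\<close> and \<open>\<sigma>_1 \<ge> \<sigma>_{-1}\<close>, \<open>\<sigma>_2 \<ge> \<sigma>_0\<close> under these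
  moves gives a finite set of forms, whose nonnegativity follows from the inequalities listed.
  They depend on which of the two root lengths the letter \<open>a\<close> has.\<close>

definition polytope :: "idx \<Rightarrow> int \<Rightarrow> int \<Rightarrow> (int \<Rightarrow> int) \<Rightarrow> bool" where
  "polytope a p q z \<longleftrightarrow> (\<forall>n. n \<notin> {1..6} \<longrightarrow> z n = 0) \<and>
     0 \<le> z 1 \<and> z 1 \<le> p \<and> 0 \<le> z 6 \<and> z 6 \<le> q \<and>
     (case a of
        Two \<Rightarrow> z 3 \<le> 3 * z 2 \<and> 3 * z 4 \<le> 2 * z 3 \<and> 2 * z 5 \<le> 3 * z 4 \<and> 3 * z 6 \<le> z 5 \<and>
          z 2 \<le> z 1 + q \<and> z 3 \<le> 2 * z 2 + q \<and> 2 * z 4 \<le> z 3 + q \<and> z 5 \<le> z 4 + q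
      | One \<Rightarrow> z 3 \<le> z 2 \<and> z 4 \<le> 2 * z 3 \<and> 2 * z 5 \<le> z 4 \<and> z 6 \<le> z 5 \<and>
          z 2 \<le> 3 * z 1 + q \<and> 3 * z 3 \<le> 2 * z 2 + q \<and> 2 * z 4 \<le> 3 * z 3 + q \<and> 3 * z 5 \<le> z 4 + q)"

lemma dsigma_values:
  "dsigma a p q z 6 = z 6"
  "dsigma a p q z 5 = z 5 + cartan_G2 a (other a) * z 6"
  "dsigma a p q z 4 = z 4 + cartan_G2 (other a) a * z 5 + 2 * z 6"
  "dsigma a p q z 3 = z 3 + cartan_G2 a (other a) * (z 4 + z 6) + 2 * z 5"
  "dsigma a p q z 2 = z 2 + cartan_G2 (other a) a * (z 3 + z 5) + 2 * (z 4 + z 6)"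
  "dsigma a p q z 1 = z 1 + cartan_G2 a (other a) * (z 2 + z 4 + z 6) + 2 * (z 3 + z 5)"
  and dsigma_right_odd: "n \<le> 0 \<Longrightarrow> odd n \<Longrightarrow> dsigma a p q z n =
    - p + z n + 2 * (z 1 + z 3 + z 5) + cartan_G2 a (other a) * (z 2 + z 4 + z 6)"
  and dsigma_right_even: "n \<le> 0 \<Longrightarrow> even n \<Longrightarrow> dsigma a p q z n =
    - q + z n + 2 * (z 2 + z 4 + z 6) + cartan_G2 (other a) a * (z 1 + z 3 + z 5)"
  and dsigma_left: "6 < n \<Longrightarrow> dsigma a p q z n = z n"
proof -
  have I: "{1..6::int} = {1,2,3,4,5,6}" by auto
  have [simp]: "cartan_G2 i i = 2" for i by (cases i) auto
  note d = dsigma_def letter_def I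
  show "dsigma a p q z 6 = z 6" "dsigma a p q z 5 = z 5 + cartan_G2 a (other a) * z 6"
    "dsigma a p q z 4 = z 4 + cartan_G2 (other a) a * z 5 + 2 * z 6"
    "dsigma a p q z 3 = z 3 + cartan_G2 a (other a) * (z 4 + z 6) + 2 * z 5"
    "dsigma a p q z 2 = z 2 + cartan_G2 (other a) a * (z 3 + z 5) + 2 * (z 4 + z 6)"
    "dsigma a p q z 1 = z 1 + cartan_G2 a (other a) * (z 2 + z 4 + z 6) + 2 * (z 3 + z 5)"
    unfolding d by (simp_all add: algebra_simps)
  show "n \<le> 0 \<Longrightarrow> odd n \<Longrightarrow> dsigma a p q z n =
    - p + z n + 2 * (z 1 + z 3 + z 5) + cartan_G2 a (other a) * (z 2 + z 4 + z 6)"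
    "n \<le> 0 \<Longrightarrow> even n \<Longrightarrow> dsigma a p q z n =
    - q + z n + 2 * (z 2 + z 4 + z 6) + cartan_G2 (other a) a * (z 1 + z 3 + z 5)"
    "6 < n \<Longrightarrow> dsigma a p q z n = z n"
    unfolding d by (simp_all add: algebra_simps)
qed

lemma dsigma_outside:
  assumes "polytope a p q z"
  shows "6 < n \<Longrightarrow> dsigma a p q z n = 0"
    and "n \<le> 0 \<Longrightarrow> dsigma a p q z n = (if odd n then dsigma a p q z (-1) else dsigma a p q z 0)"
  using assms by (auto simp: dsigma_left dsigma_right_odd dsigma_right_even polytope_def)

lemma position_cases:
  obtains "(n::int) \<le> 0" | "n = 1" | "n = 2" | "n = 3" | "n = 4" | "n = 5" | "n = 6" | "6 < n"
  by linarith

text \<open>Beyond position 6 and to the right of the weight symbol \<open>dsigma\<close> is constant on each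
  letter, so it remains to exclude the last position on the right (by \<open>\<sigma>_1 \<ge> \<sigma>_{-1}\<close> or
  \<open>\<sigma>_2 \<ge> \<sigma>_0\<close>); the positions 1 to 6 are settled by linear arithmetic.\<close>

lemma polytope_e_step:
  assumes P: "polytope a p q z"
    and strict: "\<And>m. even m = even n \<Longrightarrow> n < m \<Longrightarrow> dsigma a p q z m < dsigma a p q z n"
    and weak: "\<And>m. even m = even n \<Longrightarrow> m < n \<Longrightarrow> dsigma a p q z m \<le> dsigma a p q z n"
  shows "n \<in> {1..6} \<and> polytope a p q (z(n := z n - 1))"
proof (cases n rule: position_cases)
  case 1
  have "\<not> even n" if "n \<le> 0"
    using strict[of 2] P that
    by (cases a) (auto simp: polytope_def dsigma_values dsigma_right_even)
  moreover have "\<not> odd n" if "n \<le> 0"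
    using strict[of 1] P that
    by (cases a) (auto simp: polytope_def dsigma_values dsigma_right_odd)
  ultimately show ?thesis using 1 by blast
next
  case 2
  show ?thesis
    using P weak[of "-1"] strict[of 3] strict[of 5] strict[of 7] unfolding 2
    by (cases a) (auto simp: polytope_def dsigma_values dsigma_left dsigma_right_odd dsigma_right_even)
next
  case 3
  show ?thesis
    using P weak[of 0] strict[of 4] strict[of 6] strict[of 8] unfolding 3
    by (cases a) (auto simp: polytope_def dsigma_values dsigma_left dsigma_right_odd dsigma_right_even)
next
  case 4
  show ?thesis
    using P weak[of "-1"] weak[of 1] strict[of 5] strict[of 7] unfolding 4
    by (cases a) (auto simp: polytope_def dsigma_values dsigma_left dsigma_right_odd dsigma_right_even)
next
  case 5
  show ?thesis
    using P weak[of 0] weak[of 2] strict[of 6] strict[of 8] unfolding 5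
    by (cases a) (auto simp: polytope_def dsigma_values dsigma_left dsigma_right_odd dsigma_right_even)
next
  case 6
  show ?thesis
    using P weak[of "-1"] weak[of 1] weak[of 3] strict[of 7] unfolding 6
    by (cases a) (auto simp: polytope_def dsigma_values dsigma_left dsigma_right_odd dsigma_right_even)
next
  case 7
  show ?thesis
    using P weak[of 0] weak[of 2] weak[of 4] strict[of 8] unfolding 7
    by (cases a) (auto simp: polytope_def dsigma_values dsigma_left dsigma_right_odd dsigma_right_even)
next
  case 8
  then show ?thesis using strict[of "n + 2"] dsigma_outside(1)[OF P, of n]
      dsigma_outside(1)[OF P, of "n + 2"] by simp
qed

text \<open>Here the position to exclude is the first one beyond 6, by \<open>\<sigma>_5 \<ge> 0\<close> and \<open>\<sigma>_6 \<ge> 0\<close>.\<close>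

lemma polytope_f_step:
  assumes P: "polytope a p q z"
    and strict: "\<And>m. even m = even n \<Longrightarrow> m < n \<Longrightarrow> dsigma a p q z m < dsigma a p q z n"
    and weak: "\<And>m. even m = even n \<Longrightarrow> n < m \<Longrightarrow> dsigma a p q z m \<le> dsigma a p q z n"
  shows "n \<in> {1..6} \<and> polytope a p q (z(n := z n + 1))"
proof (cases n rule: position_cases)
  case 1
  then show ?thesis using strict[of "n - 2"] dsigma_outside(2)[OF P, of n]
      dsigma_outside(2)[OF P, of "n - 2"] by simp
next
  case 2
  show ?thesis
    using P strict[of "-1"] weak[of 3] weak[of 5] weak[of 7] unfolding 2
    by (cases a) (auto simp: polytope_def dsigma_values dsigma_left dsigma_right_odd dsigma_right_even)
next
  case 3
  show ?thesis
    using P strict[of 0] weak[of 4] weak[of 6] weak[of 8] unfolding 3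
    by (cases a) (auto simp: polytope_def dsigma_values dsigma_left dsigma_right_odd dsigma_right_even)
next
  case 4
  show ?thesis
    using P strict[of "-1"] strict[of 1] weak[of 5] weak[of 7] unfolding 4
    by (cases a) (auto simp: polytope_def dsigma_values dsigma_left dsigma_right_odd dsigma_right_even)
next
  case 5
  show ?thesis
    using P strict[of 0] strict[of 2] weak[of 6] weak[of 8] unfolding 5
    by (cases a) (auto simp: polytope_def dsigma_values dsigma_left dsigma_right_odd dsigma_right_even)
next
  case 6
  show ?thesis
    using P strict[of "-1"] strict[of 1] strict[of 3] weak[of 7] unfolding 6
    by (cases a) (auto simp: polytope_def dsigma_values dsigma_left dsigma_right_odd dsigma_right_even)
next
  case 7
  show ?thesis
    using P strict[of 0] strict[of 2] strict[of 4] weak[of 8] unfolding 7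
    by (cases a) (auto simp: polytope_def dsigma_values dsigma_left dsigma_right_odd dsigma_right_even)
next
  case 8
  have "\<not> even n"
    using strict[of 6] P 8 dsigma_outside(1)[OF P, of n] by (auto simp: polytope_def dsigma_values)
  moreover have "\<not> odd n"
    using strict[of 5] P 8 dsigma_outside(1)[OF P, of n]
    by (cases a) (auto simp: polytope_def dsigma_values)
  ultimately show ?thesis by blast
qed

text \<open>The topmost nonzero coordinate would be positive and equal to its value of \<open>dsigma\<close>.\<close>

lemma polytope_highest:
  assumes "polytope a p q z" "\<And>n. dsigma a p q z n \<le> 0"
  shows "z = (\<lambda>_. 0)"
proof
  have "z 6 = 0" "z 5 = 0" "z 4 = 0" "z 3 = 0" "z 2 = 0" "z 1 = 0"
    using assms(1) assms(2)[of 6] assms(2)[of 5] assms(2)[of 4] assms(2)[of 3]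
      assms(2)[of 2] assms(2)[of 1]
    by (cases a; auto simp: polytope_def dsigma_values)+
  then show "z n = 0" for n
    using assms(1) by (cases n rule: position_cases) (auto simp: polytope_def)
qed

definition lowest_point :: "idx \<Rightarrow> int \<Rightarrow> int \<Rightarrow> int \<Rightarrow> int" where
  "lowest_point a p q n =
     (if n \<in> {1..6} then
        (case a of
           Two \<Rightarrow> [p, p + q, 2 * p + 3 * q, p + 2 * q, p + 3 * q, q]
         | One \<Rightarrow> [p, 3 * p + q, 2 * p + q, 3 * p + 2 * q, p + q, q]) ! nat (n - 1)
      else 0)"

text \<open>Reading the coordinates upwards, each comparison with the constant value on the right
  bounds \<open>z n\<close> below in terms of the earlier coordinates, and an inequality of the polytope
  bounds it above by the same number.\<close>

lemma polytope_lowest: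
  assumes "polytope a p q z"
    and odd: "\<And>n. odd n \<Longrightarrow> dsigma a p q z n \<le> dsigma a p q z (-1)"
    and even: "\<And>n. even n \<Longrightarrow> dsigma a p q z n \<le> dsigma a p q z 0"
  shows "z = lowest_point a p q"
proof
  note P = assms(1)[unfolded polytope_def] and d = dsigma_values dsigma_right_odd dsigma_right_even
  have 1: "z 1 = p" using P odd[of 1] by (cases a) (auto simp: d)
  have 2: "z 2 = lowest_point a p q 2"
    using P even[of 2] 1 by (cases a) (auto simp: d lowest_point_def)
  have 3: "z 3 = lowest_point a p q 3"
    using P odd[of 3] 1 2 by (cases a) (auto simp: d lowest_point_def)
  have 4: "z 4 = lowest_point a p q 4"
    using P even[of 4] 1 2 3 by (cases a) (auto simp: d lowest_point_def)
  have 5: "z 5 = lowest_point a p q 5"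
    using P odd[of 5] 1 2 3 4 by (cases a) (auto simp: d lowest_point_def)
  have 6: "z 6 = lowest_point a p q 6"
    using P even[of 6] 1 2 3 4 5 by (cases a) (auto simp: d lowest_point_def)
  show "z n = lowest_point a p q n" for n
    using P 1 2 3 4 5 6 by (cases n rule: position_cases) (auto simp: lowest_point_def split: idx.splits)
qed

lemma polytope_bounded:
  assumes "polytope a p q z"
  shows "0 \<le> z n \<and> z n \<le> 3 * (p + q)"
  using assms by (cases a; cases n rule: position_cases) (auto simp: polytope_def)

section \<open>Moving the weight symbol\<close>

text \<open>The order isomorphism from the integers onto the nonzero positions that puts the
  moved weight symbol, which stands just to the right of position \<open>-j\<close>, between 0 and 1.\<close>

definition pos :: "nat \<Rightarrow> int \<Rightarrow> int" where
  "pos j n = (if n \<le> int j then n - 1 - int j else n - int j)"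

lemma pos_nonzero: "pos j n \<noteq> 0"
  by (auto simp: pos_def)

lemma pos_less_iff: "pos j m < pos j n \<longleftrightarrow> m < n"
  by (auto simp: pos_def)

lemma pos_eq_iff: "pos j m = pos j n \<longleftrightarrow> m = n"
  by (auto simp: pos_def)

lemma pos_surj: "k \<noteq> 0 \<Longrightarrow> \<exists>n. k = pos j n"
  by (rule exI[of _ "if k < 0 then k + 1 + int j else k + int j"]) (auto simp: pos_def)

lemma iota_pos: "iota (pos j n) = letter (iota (- int j)) n"
proof -
  have "even (int j) \<or> odd (int j)" by blast
  then show ?thesis by (auto simp: iota_def letter_def pos_def)
qed

lemma letter_eq_iff: "letter a m = letter a n \<longleftrightarrow> even m = even n"
  by (cases a) (auto simp: letter_def)

lemma iota_pos_eq_iff: "iota (pos j m) = iota (pos j n) \<longleftrightarrow> even m = even n"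
  by (simp add: iota_pos letter_eq_iff)

text \<open>The next simple reflection replaces the coordinates \<open>(- h_j, h_{j+1})\<close> of the moved weight
  by \<open>(h_{j+2}, - h_{j+1})\<close>, where \<open>h_k\<close> stands for \<open>hcoord l1 l2 k\<close>.\<close>

lemma hcoord_recursion:
  assumes "1 \<le> j" "j \<le> 4"
  shows "hcoord l1 l2 (j + 2) =
    - cartan_G2 (iota (- int j)) (iota (- int (j + 1))) * hcoord l1 l2 (j + 1) - hcoord l1 l2 j"
proof -
  have "j = 1 \<or> j = 2 \<or> j = 3 \<or> j = 4" using assms by auto
  then show ?thesis
    by (elim disjE) (simp_all add: hcoord_def acoef_def acoef'_def iota_def)
qed

lemma Hvec_Suc: "Hvec l1 l2 (Suc j) = (Hvec l1 l2 j)(- int (Suc j) := hcoord l1 l2 (Suc j))"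
proof
  fix k
  consider "- int j \<le> k" | "k = - int (Suc j)" | "k < - int (Suc j)" by linarith
  then show "Hvec l1 l2 (Suc j) k = ((Hvec l1 l2 j)(- int (Suc j) := hcoord l1 l2 (Suc j))) k"
    by cases (simp_all add: Hvec_def nat_add_distrib)
qed

lemma Hvec_Zinf: "Hvec l1 l2 j \<in> Zinf"
  by (auto simp: Hvec_def Zinf_def intro: finite_subset[of _ "{- int j..-1}"])

text \<open>The isomorphism \<open>T_\<lambda> \<otimes> B_i \<cong> B_i \<otimes> T_{s_i \<lambda>}\<close>, iterated \<open>j\<close> times: at \<open>Hvec\<close> the contribution of
  \<open>\<lambda>\<close> disappears from the first \<open>j\<close> positions on the right and becomes that of \<open>\<mu>\<close>
  at the others. So \<open>- hcoord l1 l2 j\<close> and \<open>hcoord l1 l2 (j + 1)\<close> are the coordinates of \<open>\<mu>\<close>.\<close>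

lemma sigma_Hvec:
  assumes "1 \<le> j" "j \<le> 5" "k \<noteq> 0"
  shows "sigma cartan_G2 (weight l1 l2) k (Hvec l1 l2 j) =
    (if - int j \<le> k then 0 else if iota k = iota (- int j) then hcoord l1 l2 j
     else - hcoord l1 l2 (j + 1))"
  using assms
proof (induction j rule: nat_induct_at_least)
  case base
  have eq: "Hvec l1 l2 1 = zero_seq(-1 := l2)"
    by (auto simp: Hvec_def zero_seq_def hcoord_def acoef'_def acoef_def fun_eq_iff)
  have z: "zero_seq \<in> Zinf" by (simp add: Zinf_def zero_seq_def)
  have s: "sigma cartan_G2 (weight l1 l2) k zero_seq = (if k < 0 then - weight l1 l2 (iota k) else 0)"
    by (simp add: sigma_def zero_seq_def)
  have "iota (-1) = Two" by (simp add: iota_def)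
  moreover have "zero_seq (-1) = 0" by (simp add: zero_seq_def)
  moreover have "iota k = One \<or> iota k = Two" by (cases "iota k") auto
  ultimately show ?case
    unfolding eq by (subst sigma_upd[OF z])
      (auto simp: s hcoord_def acoef_def acoef'_def)
next
  case (Suc j)
  let ?m = "- int (Suc j)"
  have IH: "sigma cartan_G2 (weight l1 l2) k (Hvec l1 l2 j) =
    (if - int j \<le> k then 0 else if iota k = iota (- int j) then hcoord l1 l2 j
     else - hcoord l1 l2 (j + 1))"
    using Suc by simp
  have ne: "iota ?m \<noteq> iota (- int j)" by (auto simp: iota_def)
  have H0: "Hvec l1 l2 j ?m = 0" by (simp add: Hvec_def)
  have S: "sigma cartan_G2 (weight l1 l2) k (Hvec l1 l2 (Suc j)) =
      sigma cartan_G2 (weight l1 l2) k (Hvec l1 l2 j) +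
      (if k = ?m then hcoord l1 l2 (Suc j)
       else if k < ?m then cartan_G2 (iota k) (iota ?m) * hcoord l1 l2 (Suc j) else 0)"
    unfolding Hvec_Suc by (subst sigma_upd[OF Hvec_Zinf]) (simp_all only: H0, simp_all)
  consider "- int j \<le> k" | "k = ?m" | "k < ?m" "iota k = iota ?m"
    | "k < ?m" "iota k = iota (- int j)"
    using ne by (cases "iota k"; cases "iota ?m"; cases "iota (- int j)") force+
  then show ?case
  proof cases
    case 1
    then show ?thesis using IH unfolding S by simp
  next
    case 2
    then show ?thesis using IH ne unfolding S by simp
  next
    case 3
    then show ?thesis using IH ne unfolding S by (cases "iota ?m") auto
  next
    case 4
    have "hcoord l1 l2 (j + 2) =
      - cartan_G2 (iota (- int j)) (iota ?m) * hcoord l1 l2 (Suc j) - hcoord l1 l2 j"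
      using hcoord_recursion[of j l1 l2] Suc by simp
    then show ?thesis using IH ne 4 unfolding S by auto
  qed
qed

definition rel_coord :: "int \<Rightarrow> int \<Rightarrow> nat \<Rightarrow> seq \<Rightarrow> int \<Rightarrow> int" where
  "rel_coord l1 l2 j x n = x (pos j n) - Hvec l1 l2 j (pos j n)"

definition realization :: "int \<Rightarrow> int \<Rightarrow> nat \<Rightarrow> seq set" where
  "realization l1 l2 j = {x. x 0 = 0 \<and>
     polytope (iota (- int j)) (- hcoord l1 l2 j) (hcoord l1 l2 (j + 1)) (rel_coord l1 l2 j x)}"

lemma Hvec_outside:
  assumes "j \<le> 5" "n \<notin> {1..6}" shows "Hvec l1 l2 j (pos j n) = 0"
  using assms by (auto simp: Hvec_def pos_def)

lemma realization_support:
  assumes "x \<in> realization l1 l2 j" "j \<le> 5" "k \<notin> pos j ` {1..6}"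
  shows "x k = 0"
proof (cases "k = 0")
  case False
  then obtain n where n: "k = pos j n" using pos_surj by blast
  then have "n \<notin> {1..6}" using assms(3) by auto
  moreover from this have "rel_coord l1 l2 j x n = 0"
    using assms(1) by (simp add: realization_def polytope_def)
  ultimately show ?thesis using n Hvec_outside[OF assms(2)] by (simp add: rel_coord_def)
qed (use assms in \<open>simp add: realization_def\<close>)

lemma realization_Zinf:
  assumes "x \<in> realization l1 l2 j" "j \<le> 5" shows "x \<in> Zinf"
proof -
  have "{k. x k \<noteq> 0} \<subseteq> pos j ` {1..6}" using realization_support[OF assms] by blast
  then show ?thesis using assms(1) finite_subset unfolding Zinf_def realization_def by blast
qed

lemma sigma_realization:
  assumes "x \<in> realization l1 l2 j" "1 \<le> j" "j \<le> 5"
  shows "sigma cartan_G2 (weight l1 l2) (pos j n) x =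
    dsigma (iota (- int j)) (- hcoord l1 l2 j) (hcoord l1 l2 (j + 1)) (rel_coord l1 l2 j x) n"
proof -
  let ?F = "pos j ` {1..6}" and ?a = "iota (- int j)" and ?h = "Hvec l1 l2 j"
  have F: "finite ?F" "0 \<notin> ?F" using pos_nonzero[of j] by fastforce+
  have h: "?h k = 0" if "k \<notin> ?F" for k
  proof (cases "k = 0")
    case False
    then show ?thesis using that pos_surj[of k j] Hvec_outside[OF assms(3)] by blast
  qed (simp add: Hvec_def)
  have inj: "inj_on (pos j) {1..6}" by (simp add: inj_on_def pos_eq_iff)
  have "sigma cartan_G2 (weight l1 l2) (pos j n) x =
      sigma cartan_G2 (weight l1 l2) (pos j n) ?h + rel_coord l1 l2 j x n +
      (\<Sum>k\<in>?F. if pos j n < k then cartan_G2 (iota (pos j n)) (iota k) * (x k - ?h k) else 0)"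
    unfolding rel_coord_def
    by (rule sigma_diff[OF F realization_support[OF assms(1,3)] h])
  also have "(\<Sum>k\<in>?F. if pos j n < k then cartan_G2 (iota (pos j n)) (iota k) * (x k - ?h k) else 0)
      = (\<Sum>m\<in>{1..6}. if n < m then cartan_G2 (letter ?a n) (letter ?a m) * rel_coord l1 l2 j x m else 0)"
    by (simp add: sum.reindex[OF inj] pos_less_iff iota_pos rel_coord_def cong: if_cong)
  also have "sigma cartan_G2 (weight l1 l2) (pos j n) ?h =
      (if 0 < n then 0 else if odd n then hcoord l1 l2 j else - hcoord l1 l2 (j + 1))"
  proof -
    have "- int j \<le> pos j n \<longleftrightarrow> 0 < n" by (auto simp: pos_def)
    moreover have "iota (pos j n) = iota (- int j) \<longleftrightarrow> odd n"
      unfolding iota_pos letter_def by (cases "iota (- int j)") auto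
    ultimately show ?thesis using sigma_Hvec[OF assms(2,3) pos_nonzero] by simp
  qed
  finally show ?thesis by (simp add: dsigma_def)
qed

lemma rel_coord_upd:
  "rel_coord l1 l2 j (x(pos j n := x (pos j n) + v)) =
   (rel_coord l1 l2 j x)(n := rel_coord l1 l2 j x n + v)"
  by (auto simp: rel_coord_def fun_eq_iff pos_eq_iff)

lemma realization_ext:
  assumes "x 0 = y 0" "rel_coord l1 l2 j x = rel_coord l1 l2 j y" shows "x = y"
proof
  fix k show "x k = y k"
  proof (cases "k = 0")
    case False
    then obtain n where "k = pos j n" using pos_surj by blast
    then show ?thesis using fun_cong[OF assms(2), of n] by (simp add: rel_coord_def)
  qed (use assms in simp)
qed

lemma realization_e_step:
  assumes x: "x \<in> realization l1 l2 j" and j: "1 \<le> j" "j \<le> 5"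
    and e: "e_position cartan_G2 (weight l1 l2) x k"
  shows "k \<in> pos j ` {1..6} \<and> x(k := x k - 1) \<in> realization l1 l2 j"
proof -
  let ?P = "polytope (iota (- int j)) (- hcoord l1 l2 j) (hcoord l1 l2 (j + 1))"
  let ?s = "dsigma (iota (- int j)) (- hcoord l1 l2 j) (hcoord l1 l2 (j + 1)) (rel_coord l1 l2 j x)"
  obtain n where n: "k = pos j n" using e pos_surj unfolding e_position_def by blast
  have "n \<in> {1..6} \<and> ?P ((rel_coord l1 l2 j x)(n := rel_coord l1 l2 j x n - 1))"
  proof (rule polytope_e_step)
    show "?P (rel_coord l1 l2 j x)" using x by (simp add: realization_def)
  next
    fix m :: int assume m: "even m = even n"
    show "?s m < ?s n" if "n < m"
      using e m that unfolding sigma_realization[OF x j, symmetric]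
      by (simp add: e_position_def n pos_less_iff iota_pos_eq_iff pos_nonzero)
    show "?s m \<le> ?s n" if "m < n"
      using e m that unfolding sigma_realization[OF x j, symmetric]
      by (simp add: e_position_def n pos_less_iff iota_pos_eq_iff pos_nonzero)
  qed
  then show ?thesis
    using x rel_coord_upd[of l1 l2 j x n "- 1"] pos_nonzero[of j n]
    by (auto simp: n realization_def)
qed

lemma realization_f_step:
  assumes x: "x \<in> realization l1 l2 j" and j: "1 \<le> j" "j \<le> 5"
    and f: "f_position cartan_G2 (weight l1 l2) x k"
  shows "k \<in> pos j ` {1..6} \<and> x(k := x k + 1) \<in> realization l1 l2 j"
proof -
  let ?P = "polytope (iota (- int j)) (- hcoord l1 l2 j) (hcoord l1 l2 (j + 1))"
  let ?s = "dsigma (iota (- int j)) (- hcoord l1 l2 j) (hcoord l1 l2 (j + 1)) (rel_coord l1 l2 j x)"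
  obtain n where n: "k = pos j n" using f pos_surj unfolding f_position_def by blast
  have "n \<in> {1..6} \<and> ?P ((rel_coord l1 l2 j x)(n := rel_coord l1 l2 j x n + 1))"
  proof (rule polytope_f_step)
    show "?P (rel_coord l1 l2 j x)" using x by (simp add: realization_def)
  next
    fix m :: int assume m: "even m = even n"
    show "?s m < ?s n" if "m < n"
      using f m that unfolding sigma_realization[OF x j, symmetric]
      by (simp add: f_position_def n pos_less_iff iota_pos_eq_iff pos_nonzero)
    show "?s m \<le> ?s n" if "n < m"
      using f m that unfolding sigma_realization[OF x j, symmetric]
      by (simp add: f_position_def n pos_less_iff iota_pos_eq_iff pos_nonzero)
  qed
  then show ?thesis
    using x rel_coord_upd[of l1 l2 j x n 1] pos_nonzero[of j n]
    by (auto simp: n realization_def)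
qed

lemma realization_highest:
  assumes x: "x \<in> realization l1 l2 j" and j: "1 \<le> j" "j \<le> 5"
    and e: "\<forall>i. etilde cartan_G2 (weight l1 l2) i x = None"
  shows "x = Hvec l1 l2 j"
proof (rule realization_ext)
  let ?s = "dsigma (iota (- int j)) (- hcoord l1 l2 j) (hcoord l1 l2 (j + 1)) (rel_coord l1 l2 j x)"
  have P: "polytope (iota (- int j)) (- hcoord l1 l2 j) (hcoord l1 l2 (j + 1)) (rel_coord l1 l2 j x)"
    using x by (simp add: realization_def)
  have "?s n \<le> 0" for n
  proof -
    obtain k where k: "pos j 6 < k"
      "\<forall>l. l \<noteq> 0 \<longrightarrow> iota l = iota (pos j n) \<longrightarrow>
         sigma cartan_G2 (weight l1 l2) l x \<le> sigma cartan_G2 (weight l1 l2) k x"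
      using etilde_None_maximisers[OF realization_Zinf[OF x j(2)]] e by blast
    have "k \<noteq> 0" using k(1) j by (auto simp: pos_def split: if_splits)
    then obtain m where m: "k = pos j m" using pos_surj by blast
    then have "?s n \<le> ?s m" using k(2) pos_nonzero[of j n]
      unfolding sigma_realization[OF x j, symmetric] by simp
    also have "?s m = 0" using k(1) dsigma_outside(1)[OF P] by (simp add: m pos_less_iff)
    finally show ?thesis .
  qed
  then have "rel_coord l1 l2 j x = (\<lambda>_. 0)" by (rule polytope_highest[OF P])
  then show "rel_coord l1 l2 j x = rel_coord l1 l2 j (Hvec l1 l2 j)"
    by (simp add: rel_coord_def fun_eq_iff)
  show "x 0 = Hvec l1 l2 j 0" using x by (simp add: realization_def Hvec_def)
qed

lemma rel_coord_Lvec: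
  assumes "1 \<le> j" "j \<le> 5"
  shows "rel_coord l1 l2 j (Lvec l1 l2 (6 - j)) =
    lowest_point (iota (- int j)) (- hcoord l1 l2 j) (hcoord l1 l2 (j + 1))"
proof
  fix n
  have "j = 1 \<or> j = 2 \<or> j = 3 \<or> j = 4 \<or> j = 5" using assms by auto
  then show "rel_coord l1 l2 j (Lvec l1 l2 (6 - j)) n =
    lowest_point (iota (- int j)) (- hcoord l1 l2 j) (hcoord l1 l2 (j + 1)) n"
    by (cases n rule: position_cases; elim disjE)
      (simp_all add: rel_coord_def Lvec_def Hvec_def pos_def lowest_point_def iota_def
        hcoord_def lcoord_def acoef_def acoef'_def)
qed

lemma realization_lowest:
  assumes x: "x \<in> realization l1 l2 j" and j: "1 \<le> j" "j \<le> 5"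
    and f: "\<forall>i. ftilde cartan_G2 (weight l1 l2) i x = None"
  shows "x = Lvec l1 l2 (6 - j)"
proof (rule realization_ext)
  let ?s = "dsigma (iota (- int j)) (- hcoord l1 l2 j) (hcoord l1 l2 (j + 1)) (rel_coord l1 l2 j x)"
  have P: "polytope (iota (- int j)) (- hcoord l1 l2 j) (hcoord l1 l2 (j + 1)) (rel_coord l1 l2 j x)"
    using x by (simp add: realization_def)
  have tail: "?s n \<le> (if odd n then ?s (-1) else ?s 0)" for n
  proof -
    obtain k where k: "k < pos j 1" "iota k = iota (pos j n)"
      "\<forall>l. l \<noteq> 0 \<longrightarrow> iota l = iota (pos j n) \<longrightarrow>
         sigma cartan_G2 (weight l1 l2) l x \<le> sigma cartan_G2 (weight l1 l2) k x"
      using ftilde_None_maximisers[OF realization_Zinf[OF x j(2)]] f by blast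
    have "k \<noteq> 0" using k(1) j by (auto simp: pos_def split: if_splits)
    then obtain m where m: "k = pos j m" using pos_surj by blast
    then have "?s n \<le> ?s m" using k(3) pos_nonzero[of j n]
      unfolding sigma_realization[OF x j, symmetric] by simp
    moreover have "m \<le> 0" "even m = even n"
      using k by (simp_all add: m pos_less_iff iota_pos_eq_iff)
    ultimately show ?thesis using dsigma_outside(2)[OF P, of m] by (simp split: if_splits)
  qed
  have "rel_coord l1 l2 j x = lowest_point (iota (- int j)) (- hcoord l1 l2 j) (hcoord l1 l2 (j + 1))"
  proof (rule polytope_lowest[OF P])
    show "?s n \<le> ?s (-1)" if "odd n" for n using tail[of n] that by simp
    show "?s n \<le> ?s 0" if "even n" for n using tail[of n] that by simp
  qed
  then show "rel_coord l1 l2 j x = rel_coord l1 l2 j (Lvec l1 l2 (6 - j))"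
    by (simp add: rel_coord_Lvec[OF j])
  show "x 0 = Lvec l1 l2 (6 - j) 0" using x by (simp add: realization_def Lvec_def)
qed

text \<open>In shifted coordinates the zero sequence has the entries \<open>- h_{-j}, \<dots>, - h_{-1}\<close>; it is
  the extremal vector of weight \<open>\<lambda>\<close> in \<open>B(\<mu>)\<close>.\<close>

lemma zero_in_realization:
  assumes "0 < l1" "l2 < 0" "1 \<le> j" "j \<le> 5" "hcoord l1 l2 j \<le> 0" "0 \<le> hcoord l1 l2 (j + 1)"
  shows "zero_seq \<in> realization l1 l2 j"
proof -
  have out: "\<forall>n. n \<notin> {1..6} \<longrightarrow> rel_coord l1 l2 j zero_seq n = 0"
    using Hvec_outside[OF assms(4)] by (simp add: rel_coord_def zero_seq_def)
  have "j = 1 \<or> j = 2 \<or> j = 3 \<or> j = 4 \<or> j = 5" using assms by auto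
  then show ?thesis
    using assms out unfolding realization_def polytope_def
    by (elim disjE) (simp_all add: rel_coord_def zero_seq_def Hvec_def pos_def iota_def
        hcoord_def acoef_def acoef'_def)
qed

lemma extremal_vectors_chamber:
  assumes "0 < l1" "l2 < 0" and j: "1 \<le> j" "j \<le> 5"
    and "hcoord l1 l2 j \<le> 0" "0 \<le> hcoord l1 l2 (j + 1)"
  shows "highest_weight_vectors cartan_G2 (weight l1 l2) (B0 cartan_G2 (weight l1 l2)) = {Hvec l1 l2 j}"
    and "lowest_weight_vectors cartan_G2 (weight l1 l2) (B0 cartan_G2 (weight l1 l2)) = {Lvec l1 l2 (6 - j)}"
proof -
  let ?S = "realization l1 l2 j" and ?F = "pos j ` {1..6}"
  obtain M where M: "\<bar>Hvec l1 l2 j (pos j n)\<bar> \<le> M" if "n \<in> {1..6}" for n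
    using Max_ge[of "(\<lambda>n. \<bar>Hvec l1 l2 j (pos j n)\<bar>) ` {1..6}"] by blast
  let ?C = "M + 3 * (hcoord l1 l2 (j + 1) - hcoord l1 l2 j)"
  have diag: "cartan_G2 i i = 2" for i by (cases i) auto
  have F: "finite ?F" "0 \<notin> ?F" using pos_nonzero[of j] by fastforce+
  have bound: "\<bar>x k\<bar> \<le> ?C" if x: "x \<in> ?S" for x k
  proof (cases "k \<in> ?F")
    case True
    then obtain n where n: "n \<in> {1..6}" "k = pos j n" by blast
    have b: "0 \<le> rel_coord l1 l2 j x n \<and>
        rel_coord l1 l2 j x n \<le> 3 * (- hcoord l1 l2 j + hcoord l1 l2 (j + 1))"
      using x by (intro polytope_bounded[of "iota (- int j)"]) (simp add: realization_def)
    show ?thesis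
      using M[OF n(1)] b unfolding n(2) rel_coord_def abs_le_iff by auto
  next
    case False
    have "0 \<le> ?C" using M[of 1] assms by simp
    then show ?thesis using realization_support[OF x j(2) False] by simp
  qed
  show "highest_weight_vectors cartan_G2 (weight l1 l2) (B0 cartan_G2 (weight l1 l2)) = {Hvec l1 l2 j}"
    by (rule unique_extremal_vectors(1)[where S = ?S and F = ?F and C = ?C
          and h = "Hvec l1 l2 j" and l = "Lvec l1 l2 (6 - j)"];
        (rule diag zero_in_realization[OF assms] F
         | rule bound realization_support[OF _ j(2)] realization_e_step[OF _ j]
             realization_f_step[OF _ j] realization_highest[OF _ j] realization_lowest[OF _ j];
           assumption))
  show "lowest_weight_vectors cartan_G2 (weight l1 l2) (B0 cartan_G2 (weight l1 l2)) = {Lvec l1 l2 (6 - j)}"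
    by (rule unique_extremal_vectors(2)[where S = ?S and F = ?F and C = ?C
          and h = "Hvec l1 l2 j" and l = "Lvec l1 l2 (6 - j)"];
        (rule diag zero_in_realization[OF assms] F
         | rule bound realization_support[OF _ j(2)] realization_e_step[OF _ j]
             realization_f_step[OF _ j] realization_highest[OF _ j] realization_lowest[OF _ j];
           assumption))
qed

section \<open>The chambers crossed by the ratio\<close>

lemma Lvec_drop_last:
  assumes "lcoord l1 l2 (Suc j) = 0" shows "Lvec l1 l2 (Suc j) = Lvec l1 l2 j"
proof
  fix k
  consider "k < 1" | "1 \<le> k" "k \<le> int j" | "k = int (Suc j)" | "int (Suc j) < k" by linarith
  then show "Lvec l1 l2 (Suc j) k = Lvec l1 l2 j k"
    using assms by cases (simp_all add: Lvec_def nat_add_distrib)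
qed

theorem mainTheorem8:
  fixes l1 l2 :: int
  assumes "l1 > 0" and "l2 < 0"
  shows
    "let lam = weight l1 l2;
         B = B0 cartan_G2 lam;
         HW = highest_weight_vectors cartan_G2 lam B;
         LW = lowest_weight_vectors cartan_G2 lam B;
         r = real_of_int l1 / real_of_int (- l2)
     in
     (r > 1 \<longrightarrow> HW = {Hvec l1 l2 1} \<and> LW = {Lvec l1 l2 5}) \<and>
     (r = 1 \<longrightarrow> HW = {Hvec l1 l2 1} \<and> LW = {Lvec l1 l2 4}) \<and>
     (1 > r \<and> r > 2 / 3 \<longrightarrow> HW = {Hvec l1 l2 2} \<and> LW = {Lvec l1 l2 4}) \<and>
     (r = 2 / 3 \<longrightarrow> HW = {Hvec l1 l2 2} \<and> LW = {Lvec l1 l2 3}) \<and>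
     (2 / 3 > r \<and> r > 1 / 2 \<longrightarrow> HW = {Hvec l1 l2 3} \<and> LW = {Lvec l1 l2 3}) \<and>
     (r = 1 / 2 \<longrightarrow> HW = {Hvec l1 l2 3} \<and> LW = {Lvec l1 l2 2}) \<and>
     (1 / 2 > r \<and> r > 1 / 3 \<longrightarrow> HW = {Hvec l1 l2 4} \<and> LW = {Lvec l1 l2 2}) \<and>
     (r = 1 / 3 \<longrightarrow> HW = {Hvec l1 l2 4} \<and> LW = {Lvec l1 l2 1}) \<and>
     (1 / 3 > r \<and> r > 0 \<longrightarrow> HW = {Hvec l1 l2 5} \<and> LW = {Lvec l1 l2 1})"
proof -
  let ?HW = "highest_weight_vectors cartan_G2 (weight l1 l2) (B0 cartan_G2 (weight l1 l2))"
  let ?LW = "lowest_weight_vectors cartan_G2 (weight l1 l2) (B0 cartan_G2 (weight l1 l2))"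
  define r where "r = real_of_int l1 / real_of_int (- l2)"
  have ratio: "r < real_of_int p / real_of_int q \<longleftrightarrow> q * l1 < - p * l2"
    "r > real_of_int p / real_of_int q \<longleftrightarrow> q * l1 > - p * l2"
    "r = real_of_int p / real_of_int q \<longleftrightarrow> q * l1 = - p * l2" if "q > 0" for p q :: int
  proof -
    have "r < real_of_int p / real_of_int q \<longleftrightarrow> real_of_int (q * l1) < real_of_int (- p * l2)"
      "r > real_of_int p / real_of_int q \<longleftrightarrow> real_of_int (q * l1) > real_of_int (- p * l2)"
      "r = real_of_int p / real_of_int q \<longleftrightarrow> real_of_int (q * l1) = real_of_int (- p * l2)"
      using assms that by (auto simp: r_def field_simps)
    then show "r < real_of_int p / real_of_int q \<longleftrightarrow> q * l1 < - p * l2"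
      "r > real_of_int p / real_of_int q \<longleftrightarrow> q * l1 > - p * l2"
      "r = real_of_int p / real_of_int q \<longleftrightarrow> q * l1 = - p * l2"
      by (simp_all only: of_int_less_iff of_int_eq_iff)
  qed
  have r1: "r < 1 \<longleftrightarrow> l1 < - l2" "r > 1 \<longleftrightarrow> l1 > - l2" "r = 1 \<longleftrightarrow> l1 = - l2"
    using ratio[of 1 1] by simp_all
  have r2: "r < 2 / 3 \<longleftrightarrow> 3 * l1 < - 2 * l2" "r > 2 / 3 \<longleftrightarrow> 3 * l1 > - 2 * l2"
    "r = 2 / 3 \<longleftrightarrow> 3 * l1 = - 2 * l2"
    using ratio[of 3 2] by simp_all
  have r3: "r < 1 / 2 \<longleftrightarrow> 2 * l1 < - l2" "r > 1 / 2 \<longleftrightarrow> 2 * l1 > - l2"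
    "r = 1 / 2 \<longleftrightarrow> 2 * l1 = - l2"
    using ratio[of 2 1] by simp_all
  have r4: "r < 1 / 3 \<longleftrightarrow> 3 * l1 < - l2" "r > 1 / 3 \<longleftrightarrow> 3 * l1 > - l2"
    "r = 1 / 3 \<longleftrightarrow> 3 * l1 = - l2"
    using ratio[of 3 1] by simp_all
  note coef = hcoord_def lcoord_def acoef_def acoef'_def
  note chamber = extremal_vectors_chamber[OF assms]
  have 1: "?HW = {Hvec l1 l2 1} \<and> ?LW = {Lvec l1 l2 5}" if "- l2 \<le> l1"
    using chamber[of 1] that assms by (simp add: coef)
  have 2: "?HW = {Hvec l1 l2 2} \<and> ?LW = {Lvec l1 l2 4}" if "l1 \<le> - l2" "- 2 * l2 \<le> 3 * l1"
    using chamber[of 2] that assms by (simp add: coef)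
  have 3: "?HW = {Hvec l1 l2 3} \<and> ?LW = {Lvec l1 l2 3}" if "3 * l1 \<le> - 2 * l2" "- l2 \<le> 2 * l1"
    using chamber[of 3] that assms by (simp add: coef)
  have 4: "?HW = {Hvec l1 l2 4} \<and> ?LW = {Lvec l1 l2 2}" if "2 * l1 \<le> - l2" "- l2 \<le> 3 * l1"
    using chamber[of 4] that assms by (simp add: coef)
  have 5: "?HW = {Hvec l1 l2 5} \<and> ?LW = {Lvec l1 l2 1}" if "3 * l1 \<le> - l2"
    using chamber[of 5] that assms by (simp add: coef)
  have L: "l1 = - l2 \<Longrightarrow> Lvec l1 l2 5 = Lvec l1 l2 4"
    "3 * l1 = - 2 * l2 \<Longrightarrow> Lvec l1 l2 4 = Lvec l1 l2 3"
    "2 * l1 = - l2 \<Longrightarrow> Lvec l1 l2 3 = Lvec l1 l2 2"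
    "3 * l1 = - l2 \<Longrightarrow> Lvec l1 l2 2 = Lvec l1 l2 1"
    using Lvec_drop_last[of l1 l2 4] Lvec_drop_last[of l1 l2 3] Lvec_drop_last[of l1 l2 2]
      Lvec_drop_last[of l1 l2 1, unfolded Suc_1] by (simp_all add: coef)
  have wall: "l1 = - l2 \<Longrightarrow> ?HW = {Hvec l1 l2 1} \<and> ?LW = {Lvec l1 l2 4}"
    "3 * l1 = - 2 * l2 \<Longrightarrow> ?HW = {Hvec l1 l2 2} \<and> ?LW = {Lvec l1 l2 3}"
    "2 * l1 = - l2 \<Longrightarrow> ?HW = {Hvec l1 l2 3} \<and> ?LW = {Lvec l1 l2 2}"
    "3 * l1 = - l2 \<Longrightarrow> ?HW = {Hvec l1 l2 4} \<and> ?LW = {Lvec l1 l2 1}"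
    unfolding L[symmetric] by (rule 1 2 3 4; use assms in simp)+
  have "(r > 1 \<longrightarrow> ?HW = {Hvec l1 l2 1} \<and> ?LW = {Lvec l1 l2 5}) \<and>
     (r = 1 \<longrightarrow> ?HW = {Hvec l1 l2 1} \<and> ?LW = {Lvec l1 l2 4}) \<and>
     (1 > r \<and> r > 2 / 3 \<longrightarrow> ?HW = {Hvec l1 l2 2} \<and> ?LW = {Lvec l1 l2 4}) \<and>
     (r = 2 / 3 \<longrightarrow> ?HW = {Hvec l1 l2 2} \<and> ?LW = {Lvec l1 l2 3}) \<and>
     (2 / 3 > r \<and> r > 1 / 2 \<longrightarrow> ?HW = {Hvec l1 l2 3} \<and> ?LW = {Lvec l1 l2 3}) \<and>
     (r = 1 / 2 \<longrightarrow> ?HW = {Hvec l1 l2 3} \<and> ?LW = {Lvec l1 l2 2}) \<and>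
     (1 / 2 > r \<and> r > 1 / 3 \<longrightarrow> ?HW = {Hvec l1 l2 4} \<and> ?LW = {Lvec l1 l2 2}) \<and>
     (r = 1 / 3 \<longrightarrow> ?HW = {Hvec l1 l2 4} \<and> ?LW = {Lvec l1 l2 1}) \<and>
     (1 / 3 > r \<and> r > 0 \<longrightarrow> ?HW = {Hvec l1 l2 5} \<and> ?LW = {Lvec l1 l2 1})"
    unfolding r1 r2 r3 r4
    by (((intro conjI; rule impI); rule 1 2 3 4 5 wall); simp)
  then show ?thesis by (simp only: Let_def r_def)
qed

end
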